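(* Let $\mathcal{H}_X$ be a real RKHS of functions on $X=\mathbb{R}^d$ uniformly embedded in $\mathcal{C}(X)$, let $\Omega\subseteq X$ be non-empty, and let $t\mapsto x(t)\in X$, $t\ge0$, be a continuous trajectory. If the trajectory persistently excites the subspace $\mathcal{H}_\Omega$ of $\mathcal{H}_X$ in the sense of condition PE.1, then it persistently excites $\mathcal{H}_\Omega$ in the sense of condition PE.2.
   Context: $\mathcal{H}_X$ has reproducing kernel $\mathfrak{K}:X\times X\to\mathbb{R}$, and $\mathfrak{K}_x:=\mathfrak{K}(\cdot,x)$. The evaluation functional is $\mathcal{E}_x:\mathcal{H}_X\to\mathbb{R}$, $\mathcal{E}_xf=f(x)$, with adjoint $\mathcal{E}_x^*\alpha=\alpha\mathfrak{K}_x$ for $\alpha\in\mathbb{R}$. "Uniformly embedded in $\mathcal{C}(X)$" means that all functions in $\mathcal{H}_X$ are continuous and there is $\bar k<\infty$ with $\sqrt{\mathfrak{K}(x,x)}\le\bar k$ for all $x\in X$. For non-empty $\Omega\subseteq X$, $\mathcal{H}_\Omega:=\overline{\mathrm{span}\{\mathfrak{K}_x:x\in\Omega\}}$ (closure in $\mathcal{H}_X$), and $\mathbf{P}_\Omega:\mathcal{H}_X\to\mathcal{H}_\Omega$ is the orthogonal projection. PE.1: there exist constants $\gamma_1,T_0,\delta,\Delta>0$ such that for each $t\ge T_0$ and any $g\in\mathcal{H}_X$ there exists $s\in[t,t+\Delta]$ with $$\left|\int_s^{s+\delta}\mathcal{E}_{x(\tau)}g\,d\tau\right|\ge\gamma_1\|\mathbf{P}_\Omega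 g\|_{\mathcal{H}_X}.$$ PE.2: there exist constants $\gamma_2,T_0,\Delta>0$ such that for all $t\ge T_0$ and any $g\in\mathcal{H}_X$, $$\int_t^{t+\Delta}\langle\mathcal{E}_{x(\tau)}^*\mathcal{E}_{x(\tau)}g,g\rangle_{\mathcal{H}_X}\,d\tau\ge\gamma_2\|\mathbf{P}_\Omega g\|_{\mathcal{H}_X}^2.$$ The constants in PE.1 and PE.2 need not be the same. *)

theory Defs
  imports "HOL-Analysis.Analysis"
begin

text \<open>
  The Hilbert space is a complete real inner product type \<open>'h\<close>; the linear injection
  \<open>ev\<close> identifies its elements with functions \<open>'x \<Rightarrow> real\<close>. The last assumption is the
  reproducing property: every section \<open>K(\<cdot>, x)\<close> is a member of the space and represents
  evaluation at \<open>x\<close>.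
\<close>

locale rkhs =
  fixes ev :: "'h::{real_inner, complete_space} \<Rightarrow> 'x \<Rightarrow> real"
    and K :: "'x \<Rightarrow> 'x \<Rightarrow> real"
  assumes ev_add: "ev (f + g) = (\<lambda>y. ev f y + ev g y)"
    and ev_scaleR: "ev (r *\<^sub>R f) = (\<lambda>y. r * ev f y)"
    and ev_inj: "inj ev"
    and reproducing: "\<exists>k. ev k = (\<lambda>y. K y x) \<and> (\<forall>f. ev f x = f \<bullet> k)"

definition uniformly_embedded ::
    "('h \<Rightarrow> 'x::topological_space \<Rightarrow> real) \<Rightarrow> ('x \<Rightarrow> 'x \<Rightarrow> real) \<Rightarrow> bool" where
  "uniformly_embedded ev K \<longleftrightarrow>
     (\<forall>f. continuous_on UNIV (ev f)) \<and> (\<exists>kbar. \<forall>x. sqrt (K x x) \<le> kbar)"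

definition kernel_section ::
    "('h \<Rightarrow> 'x \<Rightarrow> real) \<Rightarrow> ('x \<Rightarrow> 'x \<Rightarrow> real) \<Rightarrow> 'x \<Rightarrow> 'h" where
  "kernel_section ev K x = (THE k. ev k = (\<lambda>y. K y x))"

definition eval_at :: "('h \<Rightarrow> 'x \<Rightarrow> real) \<Rightarrow> 'x \<Rightarrow> 'h \<Rightarrow> real" where
  "eval_at ev x f = ev f x"

definition kernel_subspace ::
    "('h::real_inner \<Rightarrow> 'x \<Rightarrow> real) \<Rightarrow> ('x \<Rightarrow> 'x \<Rightarrow> real) \<Rightarrow> 'x set \<Rightarrow> 'h set" where
  "kernel_subspace ev K \<Omega> = closure (span (kernel_section ev K ` \<Omega>))"

text \<open>Intended for closed subspaces \<open>S\<close> of a complete space, where \<open>p\<close> exists and is unique.\<close>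

definition orthogonal_projection :: "'h::real_inner set \<Rightarrow> 'h \<Rightarrow> 'h" where
  "orthogonal_projection S g = (THE p. p \<in> S \<and> (\<forall>v\<in>S. orthogonal (g - p) v))"

definition PE1 ::
    "('h::real_inner \<Rightarrow> 'x \<Rightarrow> real) \<Rightarrow> ('x \<Rightarrow> 'x \<Rightarrow> real) \<Rightarrow> 'x set \<Rightarrow> (real \<Rightarrow> 'x) \<Rightarrow> bool" where
  "PE1 ev K \<Omega> x \<longleftrightarrow>
     (\<exists>\<gamma>\<^sub>1>0. \<exists>T\<^sub>0>0. \<exists>\<delta>>0. \<exists>\<Delta>>0. \<forall>t\<ge>T\<^sub>0. \<forall>g. \<exists>s\<in>{t..t + \<Delta>}.
        \<bar>integral {s..s + \<delta>} (\<lambda>\<tau>. eval_at ev (x \<tau>) g)\<bar>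
          \<ge> \<gamma>\<^sub>1 * norm (orthogonal_projection (kernel_subspace ev K \<Omega>) g))"

definition PE2 ::
    "('h::real_inner \<Rightarrow> 'x \<Rightarrow> real) \<Rightarrow> ('x \<Rightarrow> 'x \<Rightarrow> real) \<Rightarrow> 'x set \<Rightarrow> (real \<Rightarrow> 'x) \<Rightarrow> bool" where
  "PE2 ev K \<Omega> x \<longleftrightarrow>
     (\<exists>\<gamma>\<^sub>2>0. \<exists>T\<^sub>0>0. \<exists>\<Delta>>0. \<forall>t\<ge>T\<^sub>0. \<forall>g.
        integral {t..t + \<Delta>}
            (\<lambda>\<tau>. adjoint (eval_at ev (x \<tau>)) (eval_at ev (x \<tau>) g) \<bullet> g)
          \<ge> \<gamma>\<^sub>2 * (norm (orthogonal_projection (kernel_subspace ev K \<Omega>) g))\<^sup>2)"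

context rkhs
begin

lemma kernel_section:
  shows ev_kernel_section: "ev (kernel_section ev K x) = (\<lambda>y. K y x)"
    and ev_eq_inner: "ev f x = f \<bullet> kernel_section ev K x"
proof -
  obtain k where k: "ev k = (\<lambda>y. K y x)" "\<And>f. ev f x = f \<bullet> k"
    using reproducing by blast
  have "kernel_section ev K x = k"
    unfolding kernel_section_def
    by (rule the_equality) (use k(1) ev_inj in \<open>auto simp: inj_def\<close>)
  with k show "ev (kernel_section ev K x) = (\<lambda>y. K y x)" "ev f x = f \<bullet> kernel_section ev K x"
    by auto
qed

lemma adjoint_eval_at: "adjoint (eval_at ev x) = (\<lambda>\<alpha>. \<alpha> *\<^sub>R kernel_section ev K x)"
  by (rule adjoint_unique) (simp add: eval_at_def ev_eq_inner)

end

end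

theory Submission
  imports Defs
begin

text \<open>
  Since \<open>\<E>\<^sub>y\<^sup>* \<alpha> = \<alpha> K\<^sub>y\<close>, the quadratic form in the second condition is
  \<open>\<langle>\<E>\<^sub>y\<^sup>* \<E>\<^sub>y g, g\<rangle> = g(y)\<^sup>2\<close>, so that condition bounds the energy of \<open>g\<close> along the trajectory,
  whereas the first one bounds the mean of \<open>g\<close> over some window of length \<open>\<delta>\<close>. The
  Cauchy-Schwarz inequality on that window turns the latter bound into the former:
  \[ \int_s^{s+\delta} g(x(\tau))^2 d\tau \ge \frac1\delta
       \Bigl(\int_s^{s+\delta} g(x(\tau)) d\tau\Bigr)^2
     \ge \frac{\gamma_1^2}{\delta} \|P_\Omega g\|^2. \]
  As \<open>s \<in> [t, t + \<Delta>]\<close>, the window lies in \<open>[t, t + (\<Delta> + \<delta>)]\<close>, and the energy over the larger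
  interval is no smaller. The second condition therefore holds with
  \<open>\<gamma>\<^sub>2 = \<gamma>\<^sub>1\<^sup>2 / \<delta>\<close>, the same \<open>T\<^sub>0\<close>, and \<open>\<Delta> + \<delta>\<close> in place of \<open>\<Delta>\<close>.
\<close>

text \<open>
  This is the Cauchy-Schwarz inequality against the constant function 1; equivalently, the
  variance of \<open>f\<close> on the interval is nonnegative.
\<close>

lemma integral_squared_le:
  fixes f :: "real \<Rightarrow> real"
  assumes "a < b" and f: "continuous_on {a..b} f"
  shows "(integral {a..b} f)\<^sup>2 \<le> (b - a) * integral {a..b} (\<lambda>t. (f t)\<^sup>2)"
proof -
  define m where "m = integral {a..b} f / (b - a)"
  have m: "m * (b - a) = integral {a..b} f"
    using \<open>a < b\<close> by (simp add: m_def)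
  have int_f: "(f has_integral m * (b - a)) {a..b}"
    unfolding m using f by (intro integrable_integral integrable_continuous_real)
  have int_sq: "((\<lambda>t. (f t)\<^sup>2) has_integral integral {a..b} (\<lambda>t. (f t)\<^sup>2)) {a..b}"
    using f by (intro integrable_integral integrable_continuous_real continuous_intros)
  have "((\<lambda>t. (f t)\<^sup>2 - 2 * m * f t + m\<^sup>2) has_integral
      integral {a..b} (\<lambda>t. (f t)\<^sup>2) - 2 * m * (m * (b - a)) + (b - a) * m\<^sup>2) {a..b}"
    using has_integral_add[OF has_integral_diff[OF int_sq has_integral_mult_right[OF int_f]]
        has_integral_const_real[of "m\<^sup>2" a b]] \<open>a < b\<close>
    by simp
  then have "0 \<le> integral {a..b} (\<lambda>t. (f t)\<^sup>2) - 2 * m * (m * (b - a)) + (b - a) * m\<^sup>2"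
  proof (rule has_integral_nonneg)
    show "0 \<le> (f t)\<^sup>2 - 2 * m * f t + m\<^sup>2" for t
      using zero_le_power2[of "f t - m"] by (simp add: power2_diff algebra_simps)
  qed
  then have "m\<^sup>2 * (b - a) \<le> integral {a..b} (\<lambda>t. (f t)\<^sup>2)"
    by (simp add: power2_eq_square algebra_simps)
  then have "(b - a) * (m\<^sup>2 * (b - a)) \<le> (b - a) * integral {a..b} (\<lambda>t. (f t)\<^sup>2)"
    using \<open>a < b\<close> by (intro mult_left_mono) auto
  then show ?thesis
    by (simp add: m[symmetric] power2_eq_square algebra_simps)
qed

lemma (in rkhs) adjoint_eval_at_inner:
  "adjoint (eval_at ev y) (eval_at ev y g) \<bullet> g = (ev g y)\<^sup>2"
  by (simp add: adjoint_eval_at eval_at_def ev_eq_inner[of g y] inner_commute power2_eq_square)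

theorem theorem4:
  fixes ev :: "'h::{real_inner, complete_space} \<Rightarrow> real ^ 'd \<Rightarrow> real"
    and K :: "real ^ 'd \<Rightarrow> real ^ 'd \<Rightarrow> real"
    and \<Omega> :: "(real ^ 'd) set"
    and x :: "real \<Rightarrow> real ^ 'd"
  assumes "rkhs ev K"
    and "uniformly_embedded ev K"
    and "\<Omega> \<noteq> {}"
    and "continuous_on {0..} x"
    and "PE1 ev K \<Omega> x"
  shows "PE2 ev K \<Omega> x"
proof -
  interpret rkhs ev K by fact
  define N where "N g = norm (orthogonal_projection (kernel_subspace ev K \<Omega>) g)" for g
  obtain \<gamma> T \<delta> \<Delta> where pos: "\<gamma> > 0" "T > 0" "\<delta> > 0" "\<Delta> > 0"
    and PE1: "\<And>t g. t \<ge> T \<Longrightarrow> \<exists>s\<in>{t..t + \<Delta>}. \<bar>integral {s..s + \<delta>} (\<lambda>\<tau>. ev g (x \<tau>))\<bar> \<ge> \<gamma> * N g"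
    using \<open>PE1 ev K \<Omega> x\<close> unfolding PE1_def eval_at_def N_def by metis
  have cont: "continuous_on {a..b} (\<lambda>\<tau>. ev g (x \<tau>))" if "a \<ge> 0" for a b g
  proof -
    have "continuous_on UNIV (ev g)"
      using \<open>uniformly_embedded ev K\<close> by (simp add: uniformly_embedded_def)
    moreover have "continuous_on {a..b} x"
      using \<open>continuous_on {0..} x\<close> by (rule continuous_on_subset) (use that in auto)
    ultimately show ?thesis
      by (rule continuous_on_compose2) auto
  qed
  have "\<gamma>\<^sup>2 / \<delta> * (N g)\<^sup>2 \<le> integral {t..t + (\<Delta> + \<delta>)} (\<lambda>\<tau>. (ev g (x \<tau>))\<^sup>2)"
    if t: "t \<ge> T" for t g
  proof -
    obtain s where s: "t \<le> s" "s \<le> t + \<Delta>"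
      and bound: "\<gamma> * N g \<le> \<bar>integral {s..s + \<delta>} (\<lambda>\<tau>. ev g (x \<tau>))\<bar>"
      using PE1[OF t, of g] by auto
    have "0 \<le> t" "0 \<le> s"
      using pos t s by auto
    have "(\<gamma> * N g)\<^sup>2 \<le> (integral {s..s + \<delta>} (\<lambda>\<tau>. ev g (x \<tau>)))\<^sup>2"
      using power_mono[OF bound, of 2] pos by (simp add: N_def)
    also have "\<dots> \<le> \<delta> * integral {s..s + \<delta>} (\<lambda>\<tau>. (ev g (x \<tau>))\<^sup>2)"
      using integral_squared_le[OF _ cont[OF \<open>0 \<le> s\<close>], of "s + \<delta>" g] pos by simp
    also have "\<dots> \<le> \<delta> * integral {t..t + (\<Delta> + \<delta>)} (\<lambda>\<tau>. (ev g (x \<tau>))\<^sup>2)"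
      using pos s
      by (intro mult_left_mono integral_subset_le integrable_continuous_real
            continuous_on_power cont \<open>0 \<le> t\<close> \<open>0 \<le> s\<close>) auto
    finally show ?thesis
      using pos by (simp add: field_simps power_mult_distrib)
  qed
  moreover have "\<gamma>\<^sup>2 / \<delta> > 0" "\<Delta> + \<delta> > 0"
    using pos by auto
  ultimately show ?thesis
    unfolding PE2_def adjoint_eval_at_inner N_def using pos(2) by blast
qed

end
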